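(* Let $f:\mathbb{R}^d\to\mathbb{R}$ be a $C^2$ function with unique global minimum $x^*\in\mathbb{R}^d$. Let $\gamma>0$ and $c>0$, and assume that there exist $a,b>0$ such that, for all $x\in\mathbb{R}^d$, $$a\big[f(x)-f(x^* )\big]+b\|x-x^*\|^2\le (x-x^* )\cdot\big(\nabla f(x)-\nabla f(x^* )\big).$$ Then, for any initial condition $(x_0,p_0)\in\mathbb{R}^d\times\mathbb{R}^d$, there exist $\kappa>0$ and $C\in\mathbb{R}_+$ such that the solution $(x(t),p(t))$, started from $(x_0,p_0)$ at time $t=0$, of the cubically damped system $$\dot x=p,\qquad \dot p=-\nabla f(x)-\gamma p-c\,[p]^3$$ satisfies, for all $t\ge 0$, $$f(x(t))-f(x^* )+\|p(t)\|^2\le C\,\mathrm{e}^{-\kappa t}.$$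
   Context: $[p]^3$ denotes the element-wise cube of the vector $p\in\mathbb{R}^d$; $\|\cdot\|$ is the Euclidean norm and $\cdot$ the Euclidean inner product; $\mathbb{R}_+=[0,\infty)$. The constants $\kappa$ and $C$ may depend on the initial condition. *)

theory Defs
  imports "HOL-Analysis.Analysis"
begin

definition grad :: "(real^'n \<Rightarrow> real) \<Rightarrow> real^'n \<Rightarrow> real^'n" where
  "grad f x = (THE D. GDERIV f x :> D)"

text \<open>The gradient is a junk value where \<open>f\<close> is not differentiable, so differentiability of
  \<open>f\<close> is required separately. The matrix \<open>H x\<close> is the Hessian of \<open>f\<close> at \<open>x\<close>.\<close>

definition C2 :: "(real^'n \<Rightarrow> real) \<Rightarrow> bool" where
  "C2 f \<longleftrightarrow> (\<forall>x. f differentiable (at x)) \<and>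
     (\<exists>H :: real^'n \<Rightarrow> real^'n^'n.
        (\<forall>x. (grad f has_derivative (\<lambda>h. H x *v h)) (at x)) \<and> continuous_on UNIV H)"

definition unique_global_min :: "('a \<Rightarrow> real) \<Rightarrow> 'a \<Rightarrow> bool" where
  "unique_global_min f xs \<longleftrightarrow> (\<forall>y. is_arg_min f (\<lambda>_. True) y \<longleftrightarrow> y = xs)"

definition cube :: "real^'n \<Rightarrow> real^'n" where
  "cube p = (\<chi> i. (p $ i) ^ 3)"

text \<open>The derivative at the initial time is one-sided; values of \<open>x\<close> and \<open>p\<close> at negative
  times are irrelevant.\<close>

definition cubic_damped_solution ::
  "(real^'n \<Rightarrow> real) \<Rightarrow> real \<Rightarrow> real \<Rightarrow> real^'n \<Rightarrow> real^'n \<Rightarrow>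
   (real \<Rightarrow> real^'n) \<Rightarrow> (real \<Rightarrow> real^'n) \<Rightarrow> bool" where
  "cubic_damped_solution f \<gamma> c x0 p0 x p \<longleftrightarrow>
     x 0 = x0 \<and> p 0 = p0 \<and>
     (\<forall>t\<ge>0. (x has_vector_derivative p t) (at t within {0..}) \<and>
        (p has_vector_derivative
           (- grad f (x t) - \<gamma> *\<^sub>R p t - c *\<^sub>R cube (p t))) (at t within {0..}))"

end

theory Submission
  imports Defs
begin

text \<open>The energy \<open>f x + \<bar>p\<bar>\<^sup>2 / 2\<close> decreases along solutions, and its sublevel sets are bounded because
  the hypothesis forces quadratic growth of \<open>f\<close> at \<open>xs\<close>; this yields global existence. On a bounded
  set the cubic friction is dominated by a linear one, so adding a small multiple of
  \<open>(x - xs) \<bullet> p + \<gamma> / 2 * \<bar>x - xs\<bar>\<^sup>2\<close> to the energy gives a function comparable to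
  \<open>f x - f xs + \<bar>p\<bar>\<^sup>2\<close> from below whose derivative is at most \<open>- \<kappa>\<close> times itself. The rate \<open>\<kappa>\<close>
  depends on the initial energy only through the bound on \<open>\<bar>p\<bar>\<close>.\<close>

section \<open>Global solutions for Lipschitz fields\<close>

lemma integral_has_vector_derivative_atLeast:
  fixes g :: "real \<Rightarrow> 'a::banach"
  assumes "continuous_on {0..} g" "t \<ge> 0"
  shows "((\<lambda>u. integral {0..u} g) has_vector_derivative g t) (at t within {0..})"
proof -
  have "((\<lambda>u. integral {0..u} g) has_vector_derivative g t) (at t within {0..t+1})"
    using assms by (intro integral_has_vector_derivative continuous_on_subset[OF assms(1)]) auto
  moreover have "at t within {0..t+1} = at t within {0..}"
    using assms(2) by (intro at_within_nhd[of _ "{..<t+1}"]) auto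
  ultimately show ?thesis by simp
qed

text \<open>Integrating \<open>exp (k * s)\<close> gains a factor \<open>1 / k\<close>; this is the
  source of the contraction factor \<open>L / k\<close> of the Picard map.\<close>

lemma norm_integral_exp_bound:
  fixes g :: "real \<Rightarrow> 'a::banach"
  assumes "continuous_on {0..} g" "t \<ge> 0" "k > 0" "A \<ge> 0"
    and bound: "\<And>s. s \<ge> 0 \<Longrightarrow> norm (g s) \<le> A * exp (k * s)"
  shows "exp (- (k * t)) * norm (integral {0..t} g) \<le> A / k"
proof -
  have exp_int: "((\<lambda>s. A * exp (k * s)) has_integral (A / k * exp (k * t) - A / k * exp (k * 0))) {0..t}"
    using assms
    by (intro fundamental_theorem_of_calculus)
       (auto intro!: derivative_eq_intros simp flip: has_real_derivative_iff_has_vector_derivative)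
  have "norm (integral {0..t} g) \<le> integral {0..t} (\<lambda>s. A * exp (k * s))"
    using exp_int bound
    by (intro integral_norm_bound_integral integrable_continuous_real
          continuous_on_subset[OF assms(1)]) (auto intro!: continuous_intros)
  also have "\<dots> = A / k * exp (k * t) - A / k"
    unfolding integral_unique[OF exp_int] by simp
  also have "\<dots> \<le> A / k * exp (k * t)"
    using assms by simp
  finally have "exp (- (k * t)) * norm (integral {0..t} g)
      \<le> exp (- (k * t)) * (A / k * exp (k * t))"
    by (intro mult_left_mono) auto
  also have "\<dots> = A / k"
    by (simp add: exp_minus)
  finally show ?thesis .
qed

text \<open>Picard iteration on the whole half-line at once: writing \<open>z t = exp (k * t) *\<^sub>R u t\<close> with \<open>k\<close>
  larger than the Lipschitz constant, the integral equation for \<open>z\<close> becomes a fixed point equation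
  for a contraction on bounded continuous functions \<open>u\<close>. Functions are extended to negative times
  as constants, since \<open>bcontfun\<close> needs total functions.\<close>

theorem Picard_global:
  fixes F :: "'a::banach \<Rightarrow> 'a"
  assumes "L-lipschitz_on UNIV F"
  obtains z where "z 0 = z0" "\<And>t. t \<ge> 0 \<Longrightarrow> (z has_vector_derivative F (z t)) (at t within {0..})"
proof -
  \<comment> \<open>Any value above \<open>L\<close> gives \<open>L / k < 1\<close>; adding 1 also
    keeps \<open>k\<close> positive when \<open>L = 0\<close>.\<close>
  define k where "k = L + 1"
  have "L \<ge> 0" using assms lipschitz_on_nonneg by blast
  then have k: "k > 0" "L / k < 1" "L / k \<ge> 0" by (auto simp: k_def)
  have lip: "norm (F x - F y) \<le> L * norm (x - y)" for x y
    using assms by (simp add: lipschitz_on_def dist_norm)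
  have F_cont: "continuous_on UNIV F"
    using assms by (rule lipschitz_on_continuous_on)
  define g where "g = (\<lambda>(u :: real \<Rightarrow>\<^sub>C 'a) s. F (exp (k * s) *\<^sub>R apply_bcontfun u s))"
  define G where "G = (\<lambda>u t. exp (- (k * t)) *\<^sub>R (z0 + integral {0..t} (g u)))"
  have g_cont: "continuous_on {0..} (g u)" for u
    unfolding g_def by (intro continuous_on_compose2[OF F_cont] continuous_intros) auto
  have G_cont: "continuous_on {0..} (G u)" for u
  proof -
    have "continuous_on {0..} (\<lambda>t. integral {0..t} (g u))"
      unfolding continuous_on_eq_continuous_within
      by (auto intro!: has_vector_derivative_continuous
            integral_has_vector_derivative_atLeast[OF g_cont])
    then show ?thesis unfolding G_def by (intro continuous_intros)
  qed
  have G_bcont: "(\<lambda>t. G u (max 0 t)) \<in> bcontfun" for u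
  proof -
    obtain B where B: "\<And>s. norm (apply_bcontfun u s) \<le> B"
      using bounded_apply_bcontfun[of u] by (auto simp: bounded_iff)
    have B0: "B \<ge> 0" using B[of 0] norm_ge_zero order_trans by blast
    \<comment> \<open>A Lipschitz \<open>F\<close> grows at most linearly, so for bounded
      \<open>u\<close> the integrand is of order \<open>exp (k * s)\<close> and \<open>G u\<close>
      is bounded.\<close>
    have bound: "norm (g u s) \<le> (norm (F 0) + L * B) * exp (k * s)" if "s \<ge> 0" for s
    proof -
      have "norm (g u s) \<le> norm (F 0) + norm (g u s - F 0)" by norm
      also have "norm (g u s - F 0) \<le> L * (exp (k * s) * norm (apply_bcontfun u s))"
        using lip[of "exp (k * s) *\<^sub>R apply_bcontfun u s" 0] by (simp add: g_def)
      also have "\<dots> \<le> L * (exp (k * s) * B)"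
        using B \<open>L \<ge> 0\<close> by (intro mult_left_mono) auto
      also have "norm (F 0) \<le> norm (F 0) * exp (k * s)"
        using that k by (simp add: mult_le_cancel_left1)
      finally show ?thesis by (simp add: algebra_simps)
    qed
    show ?thesis
    proof (rule bcontfun_normI)
      show "continuous_on UNIV (\<lambda>t. G u (max 0 t))"
        by (intro continuous_on_compose2[OF G_cont] continuous_intros) auto
      fix t :: real
      define \<tau> where "\<tau> = max 0 t"
      have "\<tau> \<ge> 0" by (simp add: \<tau>_def)
      have "norm (G u \<tau>) \<le> exp (- (k * \<tau>)) * (norm z0 + norm (integral {0..\<tau>} (g u)))"
        unfolding G_def by (auto intro: norm_triangle_ineq)
      also have "\<dots> \<le> norm z0 + (norm (F 0) + L * B) / k"
        using norm_integral_exp_bound[OF g_cont \<open>\<tau> \<ge> 0\<close> k(1) _ bound] k \<open>\<tau> \<ge> 0\<close> \<open>L \<ge> 0\<close> B0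
        by (simp add: distrib_left add_mono mult_left_le_one_le)
      finally show "norm (G u (max 0 t)) \<le> norm z0 + (norm (F 0) + L * B) / k"
        by (simp add: \<tau>_def)
    qed
  qed
  define \<Phi> where "\<Phi> = (\<lambda>u. Bcontfun (\<lambda>t. G u (max 0 t)))"
  have \<Phi>: "apply_bcontfun (\<Phi> u) t = G u (max 0 t)" for u t
    unfolding \<Phi>_def using G_bcont by (simp add: Bcontfun_inverse)
  have "dist (\<Phi> u) (\<Phi> v) \<le> L / k * dist u v" for u v
  proof (rule dist_bound)
    fix t :: real
    define \<tau> where "\<tau> = max 0 t"
    have "\<tau> \<ge> 0" by (simp add: \<tau>_def)
    have int: "g w integrable_on {0..\<tau>}" for w
      by (intro integrable_continuous_real continuous_on_subset[OF g_cont]) auto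
    have bound: "norm (g u s - g v s) \<le> L * dist u v * exp (k * s)" for s
    proof -
      have "norm (g u s - g v s)
          \<le> L * norm (exp (k * s) *\<^sub>R apply_bcontfun u s - exp (k * s) *\<^sub>R apply_bcontfun v s)"
        unfolding g_def by (rule lip)
      also have "\<dots> = L * (exp (k * s) * dist (apply_bcontfun u s) (apply_bcontfun v s))"
        by (simp add: dist_norm flip: scaleR_diff_right)
      also have "\<dots> \<le> L * (exp (k * s) * dist u v)"
        using \<open>L \<ge> 0\<close> by (intro mult_left_mono dist_bounded) auto
      finally show ?thesis by (simp add: algebra_simps)
    qed
    have "dist (G u \<tau>) (G v \<tau>)
        = exp (- (k * \<tau>)) * norm (integral {0..\<tau>} (\<lambda>s. g u s - g v s))"
      by (simp add: G_def dist_norm int integral_diff flip: scaleR_diff_right)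
    also have "\<dots> \<le> L * dist u v / k"
      using \<open>\<tau> \<ge> 0\<close> k \<open>L \<ge> 0\<close> bound
      by (intro norm_integral_exp_bound continuous_intros g_cont) auto
    finally show "dist (apply_bcontfun (\<Phi> u) t) (apply_bcontfun (\<Phi> v) t) \<le> L / k * dist u v"
      by (simp add: \<Phi> \<tau>_def)
  qed
  then have "\<exists>!u. \<Phi> u = u"
    using k by (intro banach_fix_type) auto
  then obtain u where u: "\<Phi> u = u" by blast
  define z where "z = (\<lambda>t. z0 + integral {0..t} (g u))"
  \<comment> \<open>Multiplying the fixed point equation by \<open>exp (k * s)\<close> turns
    \<open>u\<close> back into \<open>z\<close>.\<close>
  have "g u s = F (z s)" if "s \<ge> 0" for s
    using \<Phi>[of u s] that by (simp add: u g_def G_def z_def exp_minus)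
  then have "(z has_vector_derivative F (z t)) (at t within {0..})" if "t \<ge> 0" for t
    using integral_has_vector_derivative_atLeast[OF g_cont that, of u] that
    unfolding z_def by (auto intro!: derivative_eq_intros)
  moreover have "z 0 = z0" by (simp add: z_def)
  ultimately show ?thesis using that by blast
qed

section \<open>Lyapunov functions and global existence\<close>

lemma has_real_derivative_along:
  assumes "(V has_derivative V') (at (z t))" "(z has_vector_derivative v) (at t within S)"
  shows "((\<lambda>t. V (z t)) has_real_derivative V' v) (at t within S)"
proof -
  have "((\<lambda>t. V (z t)) has_derivative (\<lambda>s. V' (s *\<^sub>R v))) (at t within S)"
    using has_derivative_compose[OF assms(2)[unfolded has_vector_derivative_def] assms(1)] .
  moreover have "(\<lambda>s. V' (s *\<^sub>R v)) = (*) (V' v)"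
    using linear_cmul[OF has_derivative_linear[OF assms(1)]] by (auto simp: mult.commute)
  ultimately show ?thesis by (simp add: has_field_derivative_def)
qed

text \<open>The product \<open>exp (\<kappa> * t) * \<phi> t\<close> is nonincreasing. The sign of
  \<open>\<kappa>\<close> is free; \<open>\<kappa> = 0\<close> yields plain monotonicity of an
  energy.\<close>

lemma exp_decay_if_deriv_le:
  fixes \<phi> \<phi>' :: "real \<Rightarrow> real"
  assumes "\<And>t. t \<ge> 0 \<Longrightarrow> (\<phi> has_real_derivative \<phi>' t) (at t within {0..})"
    and "\<And>t. t \<ge> 0 \<Longrightarrow> \<phi>' t \<le> - \<kappa> * \<phi> t" and "T \<ge> 0"
  shows "\<phi> T \<le> \<phi> 0 * exp (- \<kappa> * T)"
proof -
  define \<psi> where "\<psi> = (\<lambda>t. exp (\<kappa> * t) * \<phi> t)"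
  have deriv: "(\<psi> has_real_derivative exp (\<kappa> * t) * (\<kappa> * \<phi> t + \<phi>' t)) (at t within {0..})"
    if "t \<ge> 0" for t
    unfolding \<psi>_def using assms(1)[OF that]
    by (auto intro!: derivative_eq_intros simp: algebra_simps)
  have "\<psi> T \<le> \<psi> 0"
  proof (rule DERIV_nonpos_imp_decreasing_open[OF assms(3)])
    fix t assume t: "0 < t" "t < T"
    have "at t within {0..} = at t" using t by (intro at_within_interior) auto
    moreover have "exp (\<kappa> * t) * (\<kappa> * \<phi> t + \<phi>' t) \<le> 0"
      using assms(2)[of t] t by (simp add: mult_le_0_iff)
    ultimately show "\<exists>y. DERIV \<psi> t :> y \<and> y \<le> 0"
      using deriv[of t] t by auto
  next
    have "continuous_on {0..} \<psi>"
      unfolding continuous_on_eq_continuous_within using deriv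
      by (auto intro: DERIV_continuous)
    then show "continuous_on {0..T} \<psi>" by (rule continuous_on_subset) auto
  qed
  then show ?thesis by (simp add: \<psi>_def exp_minus field_simps)
qed

text \<open>The cutoff is 1-Lipschitz with values in [0, 1], equals 1 up to radius
  \<open>r - 1\<close> and vanishes outside radius \<open>r\<close>. Splitting the difference as in
  the product rule gives \<open>L + B\<close>.\<close>

lemma lipschitz_cutoff:
  fixes F :: "'a::real_normed_vector \<Rightarrow> 'b::real_normed_vector"
  defines "\<psi> \<equiv> \<lambda>r x. max 0 (min 1 (r - norm x))"
  assumes lip: "L-lipschitz_on (cball 0 r) F" and bdd: "\<And>x. x \<in> cball 0 r \<Longrightarrow> norm (F x) \<le> B"
    and "B \<ge> 0"
  shows "(L + B)-lipschitz_on UNIV (\<lambda>x. \<psi> r x *\<^sub>R F x)"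
proof (rule lipschitz_onI)
  have "L \<ge> 0" using lip lipschitz_on_nonneg by blast
  then show "L + B \<ge> 0" using assms(4) by simp
  have \<psi>_diff: "\<bar>\<psi> r x - \<psi> r y\<bar> \<le> norm (x - y)" for x y :: 'a
    using norm_triangle_ineq3[of x y] unfolding \<psi>_def by linarith
  have \<psi>_le: "\<bar>\<psi> r x\<bar> \<le> 1" for x :: 'a unfolding \<psi>_def by linarith
  have \<psi>_0: "\<psi> r x = 0" if "x \<notin> cball 0 r" for x :: 'a
    using that by (simp add: \<psi>_def)
  \<comment> \<open>The other point may lie outside the ball: there \<open>\<psi> r x = 0\<close>
    removes the term with \<open>F x - F y\<close>.\<close>
  have one_in: "norm (\<psi> r x *\<^sub>R F x - \<psi> r y *\<^sub>R F y) \<le> (L + B) * norm (x - y)"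
    if y: "y \<in> cball 0 r" for x y
  proof -
    have "\<bar>\<psi> r x\<bar> * norm (F x - F y) \<le> L * norm (x - y)"
    proof (cases "x \<in> cball 0 r")
      case True
      have "\<bar>\<psi> r x\<bar> * norm (F x - F y) \<le> 1 * norm (F x - F y)"
        using \<psi>_le by (intro mult_right_mono) auto
      also have "\<dots> \<le> L * norm (x - y)"
        using lipschitz_onD[OF lip True y] by (simp add: dist_norm)
      finally show ?thesis .
    qed (use \<open>L \<ge> 0\<close> \<psi>_0 in auto)
    moreover have "\<bar>\<psi> r x - \<psi> r y\<bar> * norm (F y) \<le> norm (x - y) * B"
      using \<psi>_diff bdd[OF y] by (intro mult_mono) auto
    moreover have "\<psi> r x *\<^sub>R F x - \<psi> r y *\<^sub>R F y = \<psi> r x *\<^sub>R (F x - F y) + (\<psi> r x - \<psi> r y) *\<^sub>R F y"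
      by (simp add: algebra_simps)
    ultimately show ?thesis
      using norm_triangle_ineq[of "\<psi> r x *\<^sub>R (F x - F y)" "(\<psi> r x - \<psi> r y) *\<^sub>R F y"]
      unfolding distrib_right norm_scaleR by (simp add: mult.commute)
  qed
  fix x y
  show "dist (\<psi> r x *\<^sub>R F x) (\<psi> r y *\<^sub>R F y) \<le> (L + B) * dist x y"
  proof (cases "y \<in> cball 0 r \<or> x \<in> cball 0 r")
    case True
    then show ?thesis
      using one_in[of y x] one_in[of x y] by (auto simp: dist_norm norm_minus_commute)
  next
    case False
    then show ?thesis using \<psi>_0 \<open>L + B \<ge> 0\<close> by simp
  qed
qed

text \<open>Multiplying the field by a nonnegative scalar cutoff preserves the sign of the derivative of
  \<open>V\<close>, so solutions of the truncated equation stay in the sublevel set of \<open>V\<close>, where the truncation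
  has no effect; no continuation or first exit time argument is needed.\<close>

theorem global_solution_if_Lyapunov:
  fixes F :: "'a::euclidean_space \<Rightarrow> 'a" and V :: "'a \<Rightarrow> real"
  assumes lip: "\<And>r. \<exists>L. L-lipschitz_on (cball 0 r) F"
    and V_deriv: "\<And>z. (V has_derivative V' z) (at z)"
    and V_dec: "\<And>z. V' z (F z) \<le> 0"
    and bdd: "bounded {z. V z \<le> V z0}"
  obtains z where "z 0 = z0" "\<And>t. t \<ge> 0 \<Longrightarrow> (z has_vector_derivative F (z t)) (at t within {0..})"
proof -
  obtain R where R: "\<And>z. V z \<le> V z0 \<Longrightarrow> norm z \<le> R"
    using bdd by (auto simp: bounded_iff)
  \<comment> \<open>The margin of one makes the cutoff exactly 1 wherever
    \<open>norm z \<le> R\<close>.\<close>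
  obtain L where L: "L-lipschitz_on (cball 0 (R + 1)) F" using lip by blast
  have "compact (F ` cball 0 (R + 1))"
    by (intro compact_continuous_image lipschitz_on_continuous_on[OF L]) auto
  then obtain B where "B > 0" "\<And>x. x \<in> cball 0 (R + 1) \<Longrightarrow> norm (F x) \<le> B"
    using compact_imp_bounded bounded_pos by (metis image_eqI)
  note cutoff = lipschitz_cutoff[OF L this(2) less_imp_le[OF this(1)]]
  define \<psi> where "\<psi> = (\<lambda>x::'a. max 0 (min 1 (R + 1 - norm x)))"
  obtain z where z: "z 0 = z0"
      "\<And>t. t \<ge> 0 \<Longrightarrow> (z has_vector_derivative \<psi> (z t) *\<^sub>R F (z t)) (at t within {0..})"
    using Picard_global[OF cutoff] unfolding \<psi>_def by blast
  have "V (z t) \<le> V z0" if "t \<ge> 0" for t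
  proof -
    have "V' (z t) (\<psi> (z t) *\<^sub>R F (z t)) \<le> 0" for t
      using linear_cmul[OF has_derivative_linear[OF V_deriv], of "z t"] V_dec[of "z t"]
      by (simp add: \<psi>_def mult_nonneg_nonpos)
    then have "V (z t) \<le> V (z 0) * exp (- 0 * t)"
      using that by (intro exp_decay_if_deriv_le[OF has_real_derivative_along[OF V_deriv z(2)]]) auto
    then show ?thesis by (simp add: z(1))
  qed
  then have "\<psi> (z t) = 1" if "t \<ge> 0" for t
    using R[of "z t"] that by (simp add: \<psi>_def)
  then show ?thesis using that[of z] z by simp
qed

section \<open>Gradients of C2 functions\<close>

text \<open>A linear functional is the inner product with its adjoint applied to 1; uniqueness of
  derivatives makes the description in \<open>grad\<close> well defined.\<close>

lemma GDERIV_grad: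
  assumes "f differentiable (at x)"
  shows "GDERIV f x :> grad f x"
proof -
  obtain D where D: "(f has_derivative D) (at x)"
    using assms differentiable_def by blast
  have "GDERIV f x :> adjoint D 1"
    using D adjoint_works[OF has_derivative_linear[OF D], of _ 1]
    by (simp add: gderiv_def)
  moreover have "E = E'" if "GDERIV f x :> E" "GDERIV f x :> E'" for E E'
    using has_derivative_unique[OF that[unfolded gderiv_def]] vector_eq_ldot
    by (metis (no_types))
  ultimately show ?thesis unfolding grad_def by (metis theI)
qed

lemma grad_eq_0_if_min:
  assumes "f differentiable (at x)" "\<And>y. f x \<le> f y"
  shows "grad f x = 0"
proof -
  have "(\<lambda>h. h \<bullet> grad f x) = (\<lambda>h. 0)"
    using GDERIV_grad[OF assms(1)] assms(2) unfolding gderiv_def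
    by (intro differential_zero_maxmin[of x UNIV f]) auto
  then show ?thesis by (metis inner_eq_zero_iff)
qed

lemma bounded_bilinear_matrix_vector_mult:
  "bounded_bilinear ((*v) :: real^'n^'m \<Rightarrow> real^'n \<Rightarrow> real^'m)"
  unfolding bilinear_conv_bounded_bilinear[symmetric] bilinear_def
  by (auto intro!: linearI simp: matrix_vector_right_distrib matrix_vector_mult_scaleR
      matrix_vector_mult_add_rdistrib scaleR_matrix_vector_assoc)

text \<open>The continuous Hessian is bounded on the compact ball, whose convexity permits the mean
  value inequality.\<close>

lemma C2_grad_lipschitz_on:
  fixes f :: "real^'n \<Rightarrow> real"
  assumes "C2 f"
  shows "\<exists>L. L-lipschitz_on (cball 0 r) (grad f)"
proof -
  obtain H :: "real^'n \<Rightarrow> real^'n^'n" where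
    H: "\<And>x. (grad f has_derivative (\<lambda>h. H x *v h)) (at x)" "continuous_on UNIV H"
    using assms unfolding C2_def by blast
  obtain K where K: "K \<ge> 0" "\<And>(A::real^'n^'n) h. norm (A *v h) \<le> norm A * norm h * K"
    using bounded_bilinear.nonneg_bounded[OF bounded_bilinear_matrix_vector_mult] by blast
  have "compact (H ` cball 0 r)"
    by (intro compact_continuous_image continuous_on_subset[OF H(2)]) auto
  then obtain B where B: "B > 0" "\<And>x. x \<in> cball 0 r \<Longrightarrow> norm (H x) \<le> B"
    using compact_imp_bounded bounded_pos by (metis image_eqI)
  have "onorm (\<lambda>h. H x *v h) \<le> B * K" if "x \<in> cball 0 r" for x
  proof (rule onorm_le)
    fix h :: "real^'n"
    have "norm (H x) * (norm h * K) \<le> B * (norm h * K)"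
      using B(2)[OF that] K(1) by (intro mult_right_mono) auto
    then show "norm (H x *v h) \<le> B * K * norm h"
      using K(2)[of "H x" h] by (simp add: mult_ac)
  qed
  then have "norm (grad f x - grad f y) \<le> B * K * norm (x - y)"
    if "x \<in> cball 0 r" "y \<in> cball 0 r" for x y
    using that
    by (intro differentiable_bound[where S = "cball 0 r", OF convex_cball
          has_derivative_at_withinI[OF H(1)]]) auto
  then show ?thesis
    using B(1) K(1) by (intro exI[of _ "B * K"] lipschitz_onI) (auto simp: dist_norm)
qed

section \<open>The cubic friction\<close>

text \<open>In each component the difference of cubes factors as (p^2 + p q + q^2)(p - q), and each
  of the three summands has modulus at most \<open>r\<^sup>2\<close>.\<close>

lemma norm_cube_diff_le:
  assumes "norm p \<le> r" "norm q \<le> r"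
  shows "norm (cube p - cube q) \<le> 3 * r\<^sup>2 * norm (p - q)"
proof -
  have "norm ((cube p - cube q) $ i) \<le> norm (((3 * r\<^sup>2) *\<^sub>R (p - q)) $ i)" for i
  proof -
    have pq: "\<bar>p $ i\<bar> \<le> r" "\<bar>q $ i\<bar> \<le> r"
      using assms component_le_norm_cart order_trans by blast+
    then have "r \<ge> 0" by linarith
    have "(p $ i)\<^sup>2 \<le> r\<^sup>2" "(q $ i)\<^sup>2 \<le> r\<^sup>2"
      using pq \<open>r \<ge> 0\<close> by (simp_all add: power2_le_iff_abs_le)
    moreover have "\<bar>p $ i * q $ i\<bar> \<le> r * r"
      using pq \<open>r \<ge> 0\<close> unfolding abs_mult by (intro mult_mono) auto
    ultimately have "\<bar>(p $ i)\<^sup>2 + p $ i * q $ i + (q $ i)\<^sup>2\<bar> \<le> r\<^sup>2 + r * r + r\<^sup>2"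
      using zero_le_power2[of "p $ i"] zero_le_power2[of "q $ i"] by linarith
    then have "\<bar>(p $ i)\<^sup>2 + p $ i * q $ i + (q $ i)\<^sup>2\<bar> * \<bar>p $ i - q $ i\<bar>
        \<le> 3 * r\<^sup>2 * \<bar>p $ i - q $ i\<bar>"
      by (intro mult_right_mono) (auto simp: power2_eq_square)
    moreover have "(cube p - cube q) $ i
        = ((p $ i)\<^sup>2 + p $ i * q $ i + (q $ i)\<^sup>2) * (p $ i - q $ i)"
      by (simp add: cube_def algebra_simps power2_eq_square power3_eq_cube)
    ultimately show ?thesis by (simp add: abs_mult)
  qed
  then have "norm (cube p - cube q) \<le> norm ((3 * r\<^sup>2) *\<^sub>R (p - q))"
    by (rule norm_le_componentwise_cart)
  then show ?thesis by simp
qed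

text \<open>The case \<open>q = 0\<close> of the difference estimate; its factor 3 is not sharp and
  becomes the 9 in the Young estimate.\<close>

lemma norm_cube_le: "norm (cube p) \<le> 3 * (norm p)\<^sup>2 * norm p"
proof -
  have "cube 0 = (0 :: real^'a)" by (simp add: cube_def vec_eq_iff)
  then show ?thesis using norm_cube_diff_le[of p "norm p" 0] by simp
qed

text \<open>The inner product is a sum of fourth powers, so cubic friction with \<open>c > 0\<close>
  only dissipates energy.\<close>

lemma inner_cube_nonneg: "p \<bullet> cube p \<ge> 0"
proof -
  have "p $ i * (p $ i) ^ 3 = ((p $ i)\<^sup>2)\<^sup>2" for i
    by (simp add: power2_eq_square power3_eq_cube)
  then show ?thesis by (simp add: inner_vec_def cube_def sum_nonneg)
qed

section \<open>The system as one first-order field\<close>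

definition damped_field ::
  "(real^'n \<Rightarrow> real) \<Rightarrow> real \<Rightarrow> real \<Rightarrow> (real^'n) \<times> (real^'n) \<Rightarrow> (real^'n) \<times> (real^'n)" where
  "damped_field f \<gamma> c z =
     (snd z, - grad f (fst z) - \<gamma> *\<^sub>R snd z - c *\<^sub>R cube (snd z))"

text \<open>A single curve in the product space is the form to which the existence theorem and the
  chain rule apply.\<close>

lemma cubic_damped_solution_iff:
  "cubic_damped_solution f \<gamma> c x0 p0 x p \<longleftrightarrow> (x 0, p 0) = (x0, p0) \<and>
     (\<forall>t\<ge>0. ((\<lambda>t. (x t, p t)) has_vector_derivative damped_field f \<gamma> c (x t, p t))
        (at t within {0..}))"
proof -
  have "((\<lambda>t. (x t, p t)) has_vector_derivative (u, v)) (at t within S) \<longleftrightarrow>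
      (x has_vector_derivative u) (at t within S) \<and> (p has_vector_derivative v) (at t within S)"
    for u v t S
    using has_vector_derivative_Pair[of x u t S p v]
      bounded_linear.has_vector_derivative[OF bounded_linear_fst, of "\<lambda>t. (x t, p t)" "(u, v)"]
      bounded_linear.has_vector_derivative[OF bounded_linear_snd, of "\<lambda>t. (x t, p t)" "(u, v)"]
    by auto
  then show ?thesis
    by (auto simp: cubic_damped_solution_def damped_field_def)
qed

lemma damped_field_lipschitz_on:
  assumes "C2 f"
  shows "\<exists>L. L-lipschitz_on (cball 0 r) (damped_field f \<gamma> c)"
proof -
  obtain M where M: "M-lipschitz_on (cball 0 r) (grad f)"
    using C2_grad_lipschitz_on[OF assms] by blast
  have "M \<ge> 0" using M lipschitz_on_nonneg by blast
  \<comment> \<open>One summand per term of the field: momentum, gradient, linear damping, cubic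
    damping.\<close>
  define L where "L = 1 + M + \<bar>\<gamma>\<bar> + \<bar>c\<bar> * (3 * r\<^sup>2)"
  have "norm (damped_field f \<gamma> c z - damped_field f \<gamma> c w) \<le> L * norm (z - w)"
    if zw: "norm z \<le> r" "norm w \<le> r" for z w
  proof -
    let ?d = "norm (z - w)"
    have d: "norm (fst z - fst w) \<le> ?d" "norm (snd z - snd w) \<le> ?d"
      using norm_fst_le[of "fst (z - w)" "snd (z - w)", unfolded prod.collapse]
        norm_snd_le[of "snd (z - w)" "fst (z - w)", unfolded prod.collapse] by auto
    have in_ball: "norm (fst z) \<le> r" "norm (fst w) \<le> r" "norm (snd z) \<le> r" "norm (snd w) \<le> r"
      using zw norm_fst_le[of "fst z" "snd z"] norm_fst_le[of "fst w" "snd w"]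
        norm_snd_le[of "snd z" "fst z"] norm_snd_le[of "snd w" "fst w"] by auto
    have "norm (grad f (fst z) - grad f (fst w)) \<le> M * norm (fst z - fst w)"
      using lipschitz_onD[OF M] in_ball by (simp add: dist_norm)
    also have "\<dots> \<le> M * ?d" using d \<open>M \<ge> 0\<close> by (intro mult_left_mono)
    finally have g: "norm (grad f (fst z) - grad f (fst w)) \<le> M * ?d" .
    have "norm (cube (snd z) - cube (snd w)) \<le> 3 * r\<^sup>2 * norm (snd z - snd w)"
      using in_ball by (intro norm_cube_diff_le)
    also have "\<dots> \<le> 3 * r\<^sup>2 * ?d" using d by (intro mult_left_mono) auto
    finally have "norm (c *\<^sub>R (cube (snd z) - cube (snd w))) \<le> \<bar>c\<bar> * (3 * r\<^sup>2 * ?d)"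
      by (simp add: mult_left_mono)
    moreover have "norm (\<gamma> *\<^sub>R (snd z - snd w)) \<le> \<bar>\<gamma>\<bar> * ?d"
      using d by (simp add: mult_left_mono)
    moreover have "damped_field f \<gamma> c z - damped_field f \<gamma> c w = (snd z - snd w,
        - (grad f (fst z) - grad f (fst w)) - \<gamma> *\<^sub>R (snd z - snd w)
          - c *\<^sub>R (cube (snd z) - cube (snd w)))" (is "_ = (?a, ?b)")
      by (simp add: damped_field_def algebra_simps)
    moreover have "norm (- a - b - d) \<le> norm a + norm b + norm d" for a b d :: "real^'n"
      by norm
    then have "norm (?a, ?b) \<le> norm ?a + (norm (grad f (fst z) - grad f (fst w))
        + norm (\<gamma> *\<^sub>R (snd z - snd w)) + norm (c *\<^sub>R (cube (snd z) - cube (snd w))))"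
      by (intro order_trans[OF norm_Pair_le] add_left_mono)
    ultimately show ?thesis
      using d g by (simp add: L_def algebra_simps)
  qed
  moreover have "L \<ge> 0" using \<open>M \<ge> 0\<close> by (simp add: L_def)
  ultimately show ?thesis
    by (intro exI[of _ L] lipschitz_onI) (auto simp: dist_norm)
qed

section \<open>Energy estimates\<close>

text \<open>For \<open>\<epsilon> = 0\<close> this is the mechanical energy. The term \<open>\<gamma> / 2 * \<bar>x - xs\<bar>\<^sup>2\<close> is chosen so that
  its derivative cancels the damping contribution \<open>- \<gamma> * (x - xs) \<bullet> p\<close> from the derivative of
  \<open>(x - xs) \<bullet> p\<close>.\<close>

definition modified_energy ::
  "(real^'n \<Rightarrow> real) \<Rightarrow> real^'n \<Rightarrow> real \<Rightarrow> real \<Rightarrow> (real^'n) \<times> (real^'n) \<Rightarrow> real" where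
  "modified_energy f xs \<gamma> \<epsilon> z = f (fst z) - f xs + (norm (snd z))\<^sup>2 / 2
     + \<epsilon> * ((fst z - xs) \<bullet> snd z + \<gamma> / 2 * (norm (fst z - xs))\<^sup>2)"

definition modified_energy_deriv where
  "modified_energy_deriv f xs \<gamma> \<epsilon> z h = fst h \<bullet> grad f (fst z) + snd z \<bullet> snd h
      + \<epsilon> * (fst h \<bullet> snd z + (fst z - xs) \<bullet> snd h + \<gamma> * ((fst z - xs) \<bullet> fst h))"

lemma modified_energy_has_derivative:
  assumes "f differentiable (at (fst z))"
  shows "(modified_energy f xs \<gamma> \<epsilon> has_derivative modified_energy_deriv f xs \<gamma> \<epsilon> z) (at z)"
proof -
  have "((\<lambda>z. f (fst z)) has_derivative (\<lambda>h. fst h \<bullet> grad f (fst z))) (at z)"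
    using GDERIV_grad[OF assms] unfolding gderiv_def
    by (intro has_derivative_compose[OF has_derivative_fst[OF has_derivative_ident]])
  then show ?thesis
    unfolding modified_energy_def[abs_def] modified_energy_deriv_def[abs_def] power2_norm_eq_inner
    by (auto intro!: derivative_eq_intros simp: inner_commute algebra_simps)
qed

text \<open>The work of the potential force cancels the change of \<open>f\<close>, leaving only
  friction at \<open>\<epsilon> = 0\<close>. The \<open>\<epsilon>\<close> part supplies the inner
  product with \<open>grad f\<close> that the hypothesis bounds.\<close>

lemma modified_energy_deriv_damped_field:
  "modified_energy_deriv f xs \<gamma> \<epsilon> z (damped_field f \<gamma> c z) =
    - \<gamma> * (norm (snd z))\<^sup>2 - c * (snd z \<bullet> cube (snd z))
    + \<epsilon> * ((norm (snd z))\<^sup>2 - (fst z - xs) \<bullet> grad f (fst z) - c * ((fst z - xs) \<bullet> cube (snd z)))"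
  unfolding modified_energy_deriv_def damped_field_def power2_norm_eq_inner
  by (simp add: inner_diff_right inner_commute algebra_simps)

text \<open>The hypothesis along the ray \<open>xs + s *\<^sub>R (x - xs)\<close>, divided by \<open>s\<close>, bounds the derivative of
  \<open>f\<close> along the ray from below by \<open>b * s * \<bar>x - xs\<bar>\<^sup>2\<close>.\<close>

lemma quadratic_growth:
  fixes f :: "real^'n \<Rightarrow> real"
  assumes diff: "\<And>x. f differentiable (at x)" and min: "\<And>y. f xs \<le> f y" and "a \<ge> 0"
    and le: "\<And>x. a * (f x - f xs) + b * (norm (x - xs))\<^sup>2 \<le> (x - xs) \<bullet> grad f x"
  shows "b / 2 * (norm (x - xs))\<^sup>2 \<le> f x - f xs"
proof -
  define v where "v = x - xs"
  define \<phi> where "\<phi> = (\<lambda>s. f (xs + s *\<^sub>R v) - b / 2 * s\<^sup>2 * (norm v)\<^sup>2)"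
  have deriv: "(\<phi> has_real_derivative v \<bullet> grad f (xs + s *\<^sub>R v) - b * s * (norm v)\<^sup>2) (at s)" for s
  proof -
    have "((\<lambda>s. f (xs + s *\<^sub>R v)) has_real_derivative v \<bullet> grad f (xs + s *\<^sub>R v)) (at s)"
      using GDERIV_grad[OF diff] unfolding gderiv_def
      by (intro has_real_derivative_along[where z = "\<lambda>s. xs + s *\<^sub>R v"])
         (auto intro!: derivative_eq_intros)
    then show ?thesis
      unfolding \<phi>_def by (auto intro!: derivative_eq_intros)
  qed
  \<comment> \<open>As \<open>\<phi> 0 = f xs\<close>, this is the claim. The derivative is examined
    only for \<open>0 < s\<close>, where the factor \<open>s\<close> can be cancelled.\<close>
  have "\<phi> 0 \<le> \<phi> 1"
  proof (rule DERIV_nonneg_imp_increasing_open[of 0 1 \<phi>])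
    fix s :: real assume s: "0 < s" "s < 1"
    have "a * (f (xs + s *\<^sub>R v) - f xs) \<ge> 0" using min \<open>a \<ge> 0\<close> by simp
    then have "b * (norm (s *\<^sub>R v))\<^sup>2 \<le> (s *\<^sub>R v) \<bullet> grad f (xs + s *\<^sub>R v)"
      using le[of "xs + s *\<^sub>R v"] by simp
    then have "s * (b * s * (norm v)\<^sup>2) \<le> s * (v \<bullet> grad f (xs + s *\<^sub>R v))"
      by (simp add: power_mult_distrib power2_eq_square mult_ac)
    then have "b * s * (norm v)\<^sup>2 \<le> v \<bullet> grad f (xs + s *\<^sub>R v)"
      using s by simp
    then show "\<exists>y. DERIV \<phi> s :> y \<and> 0 \<le> y" using deriv[of s] by auto
  qed (use deriv in \<open>auto intro!: continuous_at_imp_continuous_on DERIV_isCont\<close>)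
  then show ?thesis by (simp add: \<phi>_def v_def)
qed

lemma abs_inner_le_half_squares:
  fixes v p :: "'a::real_inner"
  shows "\<bar>v \<bullet> p\<bar> \<le> (norm v)\<^sup>2 / 2 + (norm p)\<^sup>2 / 2"
proof -
  have "\<bar>v \<bullet> p\<bar> \<le> norm v * norm p" by (rule Cauchy_Schwarz_ineq2)
  also have "\<dots> \<le> (norm v)\<^sup>2 / 2 + (norm p)\<^sup>2 / 2"
    using sum_squares_bound[of "norm v" "norm p"] by simp
  finally show ?thesis .
qed

text \<open>On a set where \<open>\<bar>p\<bar>\<^sup>2 \<le> Q\<close> the cubic force is at most linear in \<open>\<bar>p\<bar>\<close>, and Young's inequality
  absorbs its product with \<open>x - xs\<close> into the quadratic terms.\<close>

lemma inner_cube_Young: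
  assumes "b > 0" "(norm p)\<^sup>2 \<le> Q"
  shows "\<bar>c * (v \<bullet> cube p)\<bar> \<le> b / 2 * (norm v)\<^sup>2 + 9 * c\<^sup>2 * Q\<^sup>2 / (2 * b) * (norm p)\<^sup>2"
proof -
  define u where "u = \<bar>c\<bar> * (3 * Q * norm p)"
  have "norm (cube p) \<le> 3 * Q * norm p"
    using norm_cube_le[of p] assms(2) by (smt (verit) mult_right_mono norm_ge_zero)
  then have "\<bar>c\<bar> * (norm v * norm (cube p)) \<le> \<bar>c\<bar> * (norm v * (3 * Q * norm p))"
    by (intro mult_left_mono) auto
  moreover have "\<bar>c * (v \<bullet> cube p)\<bar> \<le> \<bar>c\<bar> * (norm v * norm (cube p))"
    using Cauchy_Schwarz_ineq2[of v "cube p"] by (simp add: abs_mult mult_left_mono)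
  ultimately have "\<bar>c * (v \<bullet> cube p)\<bar> \<le> norm v * u"
    by (simp add: u_def mult_ac)
  \<comment> \<open>The weight \<open>b\<close> spends only half of the quadratic term provided by
    the hypothesis.\<close>
  also have "\<dots> \<le> b / 2 * (norm v)\<^sup>2 + u\<^sup>2 / (2 * b)"
  proof -
    have "0 \<le> (b * norm v - u)\<^sup>2 / (2 * b)" using assms(1) by simp
    also have "\<dots> = b / 2 * (norm v)\<^sup>2 + u\<^sup>2 / (2 * b) - norm v * u"
      using assms(1) by (simp add: field_simps power2_eq_square)
    finally show ?thesis by simp
  qed
  also have "u\<^sup>2 = 9 * c\<^sup>2 * Q\<^sup>2 * (norm p)\<^sup>2"
    by (simp add: u_def power_mult_distrib)
  finally show ?thesis by simp
qed

section \<open>Existence and exponential decay\<close>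

theorem theorem3:
  fixes f :: "real^'n \<Rightarrow> real" and xs :: "real^'n" and \<gamma> c :: real
  assumes "C2 f"
    and "unique_global_min f xs"
    and "\<gamma> > 0" and "c > 0"
    and "\<exists>a>0. \<exists>b>0. \<forall>x. a * (f x - f xs) + b * (norm (x - xs))\<^sup>2
           \<le> (x - xs) \<bullet> (grad f x - grad f xs)"
  shows "\<forall>x0 p0.
     (\<exists>x p. cubic_damped_solution f \<gamma> c x0 p0 x p) \<and>
     (\<exists>\<kappa>>0. \<exists>C\<ge>0. \<forall>x p. cubic_damped_solution f \<gamma> c x0 p0 x p \<longrightarrow>
        (\<forall>t\<ge>0. f (x t) - f xs + (norm (p t))\<^sup>2 \<le> C * exp (- \<kappa> * t)))"
proof (intro allI)
  fix x0 p0 :: "real^'n"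
  let ?F = "damped_field f \<gamma> c" and ?E = "modified_energy f xs \<gamma>"
    and ?E' = "modified_energy_deriv f xs \<gamma>"
  have diff: "f differentiable (at x)" for x using assms(1) by (simp add: C2_def)
  have min: "f xs \<le> f y" for y
    using assms(2) by (auto simp: unique_global_min_def is_arg_min_linorder)
  have "grad f xs = 0" using grad_eq_0_if_min[OF diff min] .
  then obtain a b where ab: "a > 0" "b > 0"
    and le: "\<And>x. a * (f x - f xs) + b * (norm (x - xs))\<^sup>2 \<le> (x - xs) \<bullet> grad f x"
    using assms(5) by auto
  note growth = quadratic_growth[OF diff min less_imp_le[OF ab(1)] le]
  have E_deriv: "(?E \<epsilon> has_derivative ?E' \<epsilon> z) (at z)" for \<epsilon> z
    by (intro modified_energy_has_derivative diff)
  have E'_0: "?E' 0 z (?F z) \<le> 0" for z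
  proof -
    have "\<gamma> * (norm (snd z))\<^sup>2 \<ge> 0" "c * (snd z \<bullet> cube (snd z)) \<ge> 0"
      using assms(3,4) inner_cube_nonneg[of "snd z"] by simp_all
    then show ?thesis unfolding modified_energy_deriv_damped_field by simp
  qed
  \<comment> \<open>Twice the initial energy: on its sublevel set
    \<open>f (fst z) - f xs \<ge> 0\<close> bounds the momentum, and quadratic growth bounds the
    position.\<close>
  define Q where "Q = 2 * ?E 0 (x0, p0)"
  have sublevel: "(norm (snd z))\<^sup>2 \<le> Q" "(norm (fst z - xs))\<^sup>2 \<le> Q / b"
    if "?E 0 z \<le> ?E 0 (x0, p0)" for z
  proof -
    have "f (fst z) - f xs + (norm (snd z))\<^sup>2 / 2 \<le> Q / 2"
      using that by (simp add: Q_def modified_energy_def)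
    then show "(norm (snd z))\<^sup>2 \<le> Q" using min[of "fst z"] by simp
    have "b / 2 * (norm (fst z - xs))\<^sup>2 \<le> Q / 2"
      using growth[of "fst z"] \<open>_ \<le> Q / 2\<close> zero_le_power2[of "norm (snd z)"] by linarith
    then show "(norm (fst z - xs))\<^sup>2 \<le> Q / b"
      using ab(2) by (simp add: field_simps)
  qed
  have "bounded {z. ?E 0 z \<le> ?E 0 (x0, p0)}"
  proof -
    have "{z. ?E 0 z \<le> ?E 0 (x0, p0)} \<subseteq> cball xs (sqrt (Q / b)) \<times> cball 0 (sqrt Q)"
      using sublevel by (force simp: dist_norm norm_minus_commute intro: real_le_rsqrt)
    then show ?thesis
      using bounded_Times bounded_cball bounded_subset by blast
  qed
  then obtain z where "z 0 = (x0, p0)"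
      "\<And>t. t \<ge> 0 \<Longrightarrow> (z has_vector_derivative ?F (z t)) (at t within {0..})"
    using global_solution_if_Lyapunov[OF damped_field_lipschitz_on[OF assms(1)] E_deriv E'_0]
    by metis
  then have solution: "cubic_damped_solution f \<gamma> c x0 p0 (\<lambda>t. fst (z t)) (\<lambda>t. snd (z t))"
    by (simp add: cubic_damped_solution_iff)
  define K where "K = 9 * c\<^sup>2 * Q\<^sup>2 / (2 * b)"
  have "K \<ge> 0" using ab by (simp add: K_def)
  \<comment> \<open>The first entry spends at most half of the linear damping on the positive
    momentum terms; the other two let kinetic energy and quadratic growth absorb the cross term in
    \<open>lower\<close>.\<close>
  define \<epsilon> where "\<epsilon> = min (\<gamma> / (2 * (1 + K))) (min (1 / 2) (b / 2))"
  have \<epsilon>: "\<epsilon> > 0" "\<epsilon> \<le> 1 / 2" "\<epsilon> \<le> b / 2" "\<epsilon> \<le> \<gamma> / (2 * (1 + K))"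
    using assms(3) ab \<open>K \<ge> 0\<close> unfolding \<epsilon>_def min_less_iff_conj min_le_iff_disj by simp_all
  from \<epsilon>(4) have \<epsilon>K: "\<epsilon> * (1 + K) \<le> \<gamma> / 2"
    using \<open>K \<ge> 0\<close> by (simp add: field_simps)
  \<comment> \<open>The entries match the three surviving dissipation terms, in
    \<open>|p|^2\<close>, \<open>f x - f xs\<close> and \<open>|x - xs|^2\<close>; each must
    dominate its share of \<open>\<kappa>\<close> times the modified energy.\<close>
  define \<kappa> where "\<kappa> = min (\<gamma> / 2) (min (\<epsilon> * a) (\<epsilon> * b / (2 * (1 + \<gamma>))))"
  have \<kappa>: "\<kappa> > 0" "\<kappa> \<le> \<gamma> / 2" "\<kappa> \<le> \<epsilon> * a" "\<kappa> \<le> \<epsilon> * b / (2 * (1 + \<gamma>))"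
    using assms(3) ab \<epsilon>(1) unfolding \<kappa>_def min_less_iff_conj min_le_iff_disj by simp_all
  from \<kappa>(4) have \<kappa>\<gamma>: "\<kappa> * (1 + \<gamma>) \<le> \<epsilon> * b / 2"
    using assms(3) by (simp add: field_simps)
  \<comment> \<open>The cross term costs at most half of the gap in \<open>f\<close> and a quarter
    of \<open>|p|^2\<close>, hence the factor 4.\<close>
  have lower: "f (fst z) - f xs + (norm (snd z))\<^sup>2 \<le> 4 * ?E \<epsilon> z" for z
  proof -
    let ?v = "fst z - xs" and ?p = "snd z"
    have "\<epsilon> * \<bar>?v \<bullet> ?p\<bar> \<le> \<epsilon> * ((norm ?v)\<^sup>2 / 2 + (norm ?p)\<^sup>2 / 2)"
      using \<epsilon>(1) abs_inner_le_half_squares by (intro mult_left_mono) auto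
    moreover have "\<epsilon> * (norm ?v)\<^sup>2 \<le> b / 2 * (norm ?v)\<^sup>2" "\<epsilon> * (norm ?p)\<^sup>2 \<le> 1 / 2 * (norm ?p)\<^sup>2"
      using \<epsilon> by (intro mult_right_mono; simp)+
    moreover have "\<epsilon> * (?v \<bullet> ?p) \<ge> - (\<epsilon> * \<bar>?v \<bullet> ?p\<bar>)"
      using \<epsilon>(1) by (simp add: abs_if)
    moreover have "\<epsilon> * (\<gamma> / 2 * (norm ?v)\<^sup>2) \<ge> 0" using \<epsilon>(1) assms(3) by simp
    ultimately show ?thesis
      using growth[of "fst z"] min[of "fst z"] by (simp add: modified_energy_def distrib_left)
  qed
  have upper: "\<kappa> * ?E \<epsilon> z \<le> \<gamma> / 2 * (norm (snd z))\<^sup>2 + \<epsilon> * a * (f (fst z) - f xs)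
      + \<epsilon> * b / 2 * (norm (fst z - xs))\<^sup>2" for z
  proof -
    let ?v = "fst z - xs" and ?p = "snd z"
    let ?I = "?v \<bullet> ?p + \<gamma> / 2 * (norm ?v)\<^sup>2"
    let ?J = "(norm ?p)\<^sup>2 / 2 + (1 + \<gamma>) / 2 * (norm ?v)\<^sup>2"
    have "?I \<le> ?J"
      using abs_inner_le_half_squares[of ?v ?p] by (simp add: field_simps)
    then have "\<epsilon> * ?I \<le> \<epsilon> * ?J" using \<epsilon>(1) by (intro mult_left_mono) auto
    also have "\<dots> \<le> 1 * ?J" using \<epsilon> assms(3) by (intro mult_right_mono) auto
    finally have "\<epsilon> * ?I \<le> ?J" by simp
    moreover have "(1 + \<gamma>) * (norm ?v)\<^sup>2 \<ge> 0" using assms(3) by simp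
    ultimately have E_le: "?E \<epsilon> z \<le> (f (fst z) - f xs) + (norm ?p)\<^sup>2 + (1 + \<gamma>) * (norm ?v)\<^sup>2"
      by (simp add: modified_energy_def)
    have "\<kappa> * ?E \<epsilon> z \<le> \<kappa> * (f (fst z) - f xs) + \<kappa> * (norm ?p)\<^sup>2
        + \<kappa> * (1 + \<gamma>) * (norm ?v)\<^sup>2"
      using mult_left_mono[OF E_le less_imp_le[OF \<kappa>(1)]]
      by (simp only: distrib_left[of \<kappa> "_ + _"] distrib_left[of \<kappa> "_ - _"] mult.assoc)
    moreover have "\<kappa> * (f (fst z) - f xs) \<le> \<epsilon> * a * (f (fst z) - f xs)"
      using \<kappa> min[of "fst z"] by (intro mult_right_mono) auto
    moreover have "\<kappa> * (norm ?p)\<^sup>2 \<le> \<gamma> / 2 * (norm ?p)\<^sup>2"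
      using \<kappa> by (intro mult_right_mono) auto
    moreover have "\<kappa> * (1 + \<gamma>) * (norm ?v)\<^sup>2 \<le> \<epsilon> * b / 2 * (norm ?v)\<^sup>2"
      using \<kappa>\<gamma> by (intro mult_right_mono) auto
    ultimately show ?thesis by linarith
  qed
  have dissipation: "?E' \<epsilon> z (?F z) \<le> - \<kappa> * ?E \<epsilon> z" if "(norm (snd z))\<^sup>2 \<le> Q" for z
  proof -
    let ?v = "fst z - xs" and ?p = "snd z"
    have "(norm ?p)\<^sup>2 - ?v \<bullet> grad f (fst z) - c * (?v \<bullet> cube ?p)
        \<le> (1 + K) * (norm ?p)\<^sup>2 - a * (f (fst z) - f xs) - b / 2 * (norm ?v)\<^sup>2"
      using le[of "fst z"] inner_cube_Young[OF ab(2) that, of c ?v]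
      unfolding K_def by (simp add: algebra_simps)
    then have "\<epsilon> * ((norm ?p)\<^sup>2 - ?v \<bullet> grad f (fst z) - c * (?v \<bullet> cube ?p))
        \<le> \<epsilon> * ((1 + K) * (norm ?p)\<^sup>2 - a * (f (fst z) - f xs) - b / 2 * (norm ?v)\<^sup>2)"
      using \<epsilon>(1) by (intro mult_left_mono) auto
    also have "\<dots> = \<epsilon> * (1 + K) * (norm ?p)\<^sup>2 - \<epsilon> * a * (f (fst z) - f xs)
        - \<epsilon> * b / 2 * (norm ?v)\<^sup>2"
      by (simp add: algebra_simps)
    also have "\<dots> \<le> \<gamma> / 2 * (norm ?p)\<^sup>2 - \<epsilon> * a * (f (fst z) - f xs) - \<epsilon> * b / 2 * (norm ?v)\<^sup>2"
      using \<epsilon>K by (intro diff_right_mono mult_right_mono) auto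
    \<comment> \<open>The other half of the damping and the negative terms dominate the energy by
      \<open>upper\<close>; the cubic friction is dropped by its sign.\<close>
    finally show ?thesis
      using upper[of z] assms(4) mult_nonneg_nonneg[OF _ inner_cube_nonneg[of ?p], of c]
      by (simp add: modified_energy_deriv_damped_field)
  qed
  \<comment> \<open>Fixed by the initial data before any solution is chosen, so one constant serves
    every solution.\<close>
  define C where "C = 4 * ?E \<epsilon> (x0, p0)"
  have "C \<ge> 0"
    using lower[of "(x0, p0)"] min[of x0] by (simp add: C_def) (smt (verit) zero_le_power2)
  moreover have "f (x t) - f xs + (norm (p t))\<^sup>2 \<le> C * exp (- \<kappa> * t)"
    if sol: "cubic_damped_solution f \<gamma> c x0 p0 x p" and "t \<ge> 0" for x p t
  proof -
    define z where "z = (\<lambda>t. (x t, p t))"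
    have z: "z 0 = (x0, p0)"
        "\<And>t. t \<ge> 0 \<Longrightarrow> (z has_vector_derivative ?F (z t)) (at t within {0..})"
      using sol by (auto simp: cubic_damped_solution_iff z_def)
    note along = has_real_derivative_along[OF E_deriv z(2)]
    \<comment> \<open>Monotonicity of the plain energy confines the solution to
      \<open>|p|^2 \<le> Q\<close>, the region where \<open>dissipation\<close> holds.\<close>
    have "?E 0 (z s) \<le> ?E 0 (z 0) * exp (- 0 * s)" if "s \<ge> 0" for s
      using that E'_0 by (intro exp_decay_if_deriv_le[OF along]) auto
    then have "(norm (snd (z s)))\<^sup>2 \<le> Q" if "s \<ge> 0" for s
      using that sublevel(1)[of "z s"] by (simp add: z(1))
    then have "?E \<epsilon> (z t) \<le> ?E \<epsilon> (z 0) * exp (- \<kappa> * t)"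
      using \<open>t \<ge> 0\<close> dissipation by (intro exp_decay_if_deriv_le[OF along]) auto
    then show ?thesis
      using lower[of "z t"] z(1) by (simp add: C_def z_def)
  qed
  ultimately show "(\<exists>x p. cubic_damped_solution f \<gamma> c x0 p0 x p) \<and>
     (\<exists>\<kappa>>0. \<exists>C\<ge>0. \<forall>x p. cubic_damped_solution f \<gamma> c x0 p0 x p \<longrightarrow>
        (\<forall>t\<ge>0. f (x t) - f xs + (norm (p t))\<^sup>2 \<le> C * exp (- \<kappa> * t)))"
    using solution \<kappa>(1) by blast
qed

end
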